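(* Let $(\mathcal{X},\Sigma_{\mathcal{X}})$ be a measurable space and let $\mathcal{M}$ be any probability measure on $\mathcal{X}$. Suppose there exists a measurable mapping $S:\mathcal{X}\to\mathcal{X}$ such that (P1) $S$ is an involution, i.e. $S\circ S=I$; (P2) $S^*\mathcal{M}$ is absolutely continuous with respect to $\mathcal{M}$. Consider the Markov kernel $Q(\mathbf{u},d\tilde{\mathbf{u}})=\delta_{S(\mathbf{u})}(d\tilde{\mathbf{u}})$, $\mathbf{u}\in\mathcal{X}$, and the measures on $\mathcal{X}\times\mathcal{X}$ $$\eta(d\mathbf{u},d\tilde{\mathbf{u}})=Q(\mathbf{u},d\tilde{\mathbf{u}})\,\mathcal{M}(d\mathbf{u}),\qquad\eta^\perp(d\mathbf{u},d\tilde{\mathbf{u}})=\eta(d\tilde{\mathbf{u}},d\mathbf{u}).$$ Then $\eta$ and $\eta^\perp$ are mutually absolutely continuous, with $$\frac{d\eta^\perp}{d\eta}(\mathbf{u},\tilde{\mathbf{u}})=\frac{dS^*\mathcal{M}}{d\mathcal{M}}(\mathbf{u})\qquad\text{for }\eta\text{-a.e. }(\mathbf{u},\tilde{\mathbf{u}})\in\mathcal{X}\times\mathcal{X}.$$ Consequently, with $\alpha(\mathbf{u},\tilde{\mathbf{u}})=1\wedge\frac{d\eta^\perp}{d\eta}(\mathbf{u},\tilde{\mathbf{u}})$, the Markov kernel on $\mathcal{X}$ $$\bar P(\mathbf{u},d\tilde{\mathbf{u}})=\alpha(\mathbf{u},\tilde{\mathbf{u}})\,\delta_{S(\mathbf{u})}(d\tilde{\mathbf{u}})+\delta_{\mathbf{u}}(d\tilde{\mathbf{u}})\,[1-\alpha(\mathbf{u},S(\mathbf{u}))]$$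 satisfies detailed balance with respect to $\mathcal{M}$, i.e. $\bar P(\mathbf{u},d\tilde{\mathbf{u}})\,\mathcal{M}(d\mathbf{u})=\bar P(\tilde{\mathbf{u}},d\mathbf{u})\,\mathcal{M}(d\tilde{\mathbf{u}})$ as measures on $\mathcal{X}\times\mathcal{X}$.
   Context: The pushforward of a measure $\nu$ by a measurable map $\phi$ is $\phi^*\nu(A)=\nu(\phi^{-1}(A))$. $a\wedge b=\min(a,b)$; $\delta_x$ is the Dirac measure at $x$; $\mathcal{X}\times\mathcal{X}$ carries the product $\sigma$-algebra. $\eta(d\tilde{\mathbf{u}},d\mathbf{u})$ means the pushforward of $\eta$ under the coordinate swap. *)

theory Defs
  imports "HOL-Probability.Probability"
begin

text \<open>
  A Markov kernel on the measurable space underlying \<open>M\<close> is a map \<open>K \<in> M \<rightarrow>\<^sub>M prob_algebra M\<close>: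
  every \<open>K u\<close> is a probability measure on \<open>M\<close>, and \<open>u \<mapsto> K u A\<close> is measurable for every
  measurable \<open>A\<close>. Such a kernel together with \<open>M\<close> gives the measure
  \<open>K(u, dv) M(du)\<close> on the product space; see \<open>emeasure_kernel_joint\<close>.
\<close>

definition kernel_joint :: "'a measure \<Rightarrow> ('a \<Rightarrow> 'a measure) \<Rightarrow> ('a \<times> 'a) measure" where
  "kernel_joint M K =
     bind M (\<lambda>u. bind (K u) (\<lambda>v. return (M \<Otimes>\<^sub>M M) (u, v)))"

lemma emeasure_kernel_joint:
  assumes M: "prob_space M" and K: "K \<in> M \<rightarrow>\<^sub>M prob_algebra M"
    and A: "A \<in> sets (M \<Otimes>\<^sub>M M)"
  shows "emeasure (kernel_joint M K) A = (\<integral>\<^sup>+u. \<integral>\<^sup>+v. indicator A (u, v) \<partial>K u \<partial>M)"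
proof -
  have MM: "M \<in> space (prob_algebra M)"
    using M by (simp add: space_prob_algebra)
  have ret: "(\<lambda>(u, v). return (M \<Otimes>\<^sub>M M) (u, v)) \<in> M \<Otimes>\<^sub>M M \<rightarrow>\<^sub>M prob_algebra (M \<Otimes>\<^sub>M M)"
    by (simp add: measurable_return_prob_space)
  have inner: "(\<lambda>u. bind (K u) (\<lambda>v. return (M \<Otimes>\<^sub>M M) (u, v))) \<in> M \<rightarrow>\<^sub>M prob_algebra (M \<Otimes>\<^sub>M M)"
    by (rule measurable_bind_prob_space2[OF K]) (use ret in \<open>simp add: case_prod_beta'\<close>)
  have "emeasure (kernel_joint M K) A =
      (\<integral>\<^sup>+u. emeasure (bind (K u) (\<lambda>v. return (M \<Otimes>\<^sub>M M) (u, v))) A \<partial>M)"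
    unfolding kernel_joint_def by (rule emeasure_bind_prob_algebra[OF MM inner A])
  also have "\<dots> = (\<integral>\<^sup>+u. \<integral>\<^sup>+v. indicator A (u, v) \<partial>K u \<partial>M)"
  proof (rule nn_integral_cong)
    fix u assume u: "u \<in> space M"
    have Ku: "K u \<in> space (prob_algebra M)"
      using K u by (rule measurable_space)
    have r: "(\<lambda>v. return (M \<Otimes>\<^sub>M M) (u, v)) \<in> M \<rightarrow>\<^sub>M prob_algebra (M \<Otimes>\<^sub>M M)"
      by (rule measurable_compose[OF measurable_Pair1'[OF u] measurable_return_prob_space])
    show "emeasure (bind (K u) (\<lambda>v. return (M \<Otimes>\<^sub>M M) (u, v))) A
        = (\<integral>\<^sup>+v. indicator A (u, v) \<partial>K u)"
      using A by (subst emeasure_bind_prob_algebra[OF Ku r A]) (simp add: emeasure_return)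
  qed
  finally show ?thesis .
qed

definition swap_measure :: "('a \<times> 'a) measure \<Rightarrow> ('a \<times> 'a) measure" where
  "swap_measure N = distr N N (\<lambda>(u, v). (v, u))"

definition sum_measure :: "'a measure \<Rightarrow> 'a measure \<Rightarrow> 'a measure" where
  "sum_measure N L = measure_of (space N) (sets N) (\<lambda>A. emeasure N A + emeasure L A)"

lemma space_sum_measure [simp]: "space (sum_measure N L) = space N"
  and sets_sum_measure [simp]: "sets (sum_measure N L) = sets N"
  by (auto simp: sum_measure_def)

lemma emeasure_sum_measure:
  assumes "sets N = sets L" "A \<in> sets N"
  shows "emeasure (sum_measure N L) A = emeasure N A + emeasure L A"
  unfolding sum_measure_def
proof (rule emeasure_measure_of_sigma)
  show "sigma_algebra (space N) (sets N)" ..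
  show "positive (sets N) (\<lambda>A. emeasure N A + emeasure L A)"
    by (simp add: positive_def)
  show "countably_additive (sets N) (\<lambda>A. emeasure N A + emeasure L A)"
    using assms(1)
    by (auto simp: countably_additive_def suminf_add[symmetric] suminf_emeasure)
qed (use assms in auto)

definition det_kernel :: "'a measure \<Rightarrow> ('a \<Rightarrow> 'a) \<Rightarrow> 'a \<Rightarrow> 'a measure" where
  "det_kernel M S u = return M (S u)"

definition eta :: "'a measure \<Rightarrow> ('a \<Rightarrow> 'a) \<Rightarrow> ('a \<times> 'a) measure" where
  "eta M S = kernel_joint M (det_kernel M S)"

definition eta_perp :: "'a measure \<Rightarrow> ('a \<Rightarrow> 'a) \<Rightarrow> ('a \<times> 'a) measure" where
  "eta_perp M S = swap_measure (eta M S)"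

text \<open>
  The Metropolis-Hastings kernel of the deterministic proposal \<open>S\<close> with acceptance
  probability \<open>\<alpha>\<close>. Subtraction on \<^typ>\<open>ennreal\<close> is truncated at 0; this is harmless
  for \<open>\<alpha> \<le> 1\<close>.
\<close>

definition mh_kernel ::
  "'a measure \<Rightarrow> ('a \<Rightarrow> 'a) \<Rightarrow> ('a \<times> 'a \<Rightarrow> ennreal) \<Rightarrow> 'a \<Rightarrow> 'a measure" where
  "mh_kernel M S \<alpha> u =
     sum_measure
       (density (return M (S u)) (\<lambda>v. \<alpha> (u, v)))
       (scale_measure (1 - \<alpha> (u, S u)) (return M u))"

text \<open>
  Detailed balance \<open>K(u, dv) M(du) = K(v, du) M(dv)\<close>, as an equality of measures on the product
  space.
\<close>

definition detailed_balance :: "'a measure \<Rightarrow> ('a \<Rightarrow> 'a measure) \<Rightarrow> bool" where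
  "detailed_balance M K \<longleftrightarrow> kernel_joint M K = swap_measure (kernel_joint M K)"

end

theory Submission
  imports Defs
begin

text \<open>
  Both joint measures are images of \<open>M\<close>: \<open>eta\<close> under \<open>u \<mapsto> (u, S u)\<close> and \<open>eta_perp\<close> under
  \<open>u \<mapsto> (S u, u)\<close>. As \<open>S\<close> is an involution, the latter is the image of the pushforward
  \<open>N = r M\<close> of \<open>M\<close> under \<open>u \<mapsto> (u, S u)\<close>, so its density with respect to \<open>eta\<close> is \<open>r (fst p)\<close>.
  Changing variables twice gives \<open>r (S u) r u = 1\<close> almost everywhere, hence
  \<open>min 1 (r (S u)) r u = min 1 (r u)\<close>; this is the symmetry of the accepted part of the
  Metropolis-Hastings kernel, while the rejected part lives on the diagonal.
\<close>

section \<open>Joint measures of kernels and the coordinate swap\<close>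

lemma sets_kernel_joint:
  assumes "prob_space M" and K: "K \<in> M \<rightarrow>\<^sub>M prob_algebra M"
  shows "sets (kernel_joint M K) = sets (M \<Otimes>\<^sub>M M)"
proof -
  have ret: "(\<lambda>(u, v). return (M \<Otimes>\<^sub>M M) (u, v)) \<in> M \<Otimes>\<^sub>M M \<rightarrow>\<^sub>M prob_algebra (M \<Otimes>\<^sub>M M)"
    by (simp add: measurable_return_prob_space)
  have inner: "(\<lambda>u. bind (K u) (\<lambda>v. return (M \<Otimes>\<^sub>M M) (u, v))) \<in> M \<rightarrow>\<^sub>M prob_algebra (M \<Otimes>\<^sub>M M)"
    by (rule measurable_bind_prob_space2[OF K]) (use ret in \<open>simp add: case_prod_beta'\<close>)
  show ?thesis
    unfolding kernel_joint_def
    using prob_space.not_empty[OF assms(1)]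
    by (intro sets_bind sets_kernel[OF measurable_prob_algebraD[OF inner]])
qed

text \<open>Evaluating each slice \<open>K u\<close> on a whole section allows the closed formulas
  for \<open>det_kernel\<close> and \<open>mh_kernel\<close> to be substituted under the
  integral.\<close>

lemma emeasure_kernel_joint_section:
  assumes "prob_space M" and K: "K \<in> M \<rightarrow>\<^sub>M prob_algebra M"
    and A: "A \<in> sets (M \<Otimes>\<^sub>M M)"
  shows "emeasure (kernel_joint M K) A = (\<integral>\<^sup>+u. emeasure (K u) (Pair u -` A) \<partial>M)"
  unfolding emeasure_kernel_joint[OF assms]
proof (rule nn_integral_cong)
  fix u assume "u \<in> space M"
  then have "sets (K u) = sets M"
    using sets_kernel[OF measurable_prob_algebraD[OF K]] by simp
  then have "Pair u -` A \<in> sets (K u)"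
    using sets_Pair1[OF A] by simp
  then show "(\<integral>\<^sup>+v. indicator A (u, v) \<partial>K u) = emeasure (K u) (Pair u -` A)"
    by (subst nn_integral_indicator[symmetric])
      (auto intro!: nn_integral_cong simp del: nn_integral_indicator split: split_indicator)
qed

lemma emeasure_swap_measure:
  assumes "sets N = sets (M \<Otimes>\<^sub>M M)" and "A \<in> sets (M \<Otimes>\<^sub>M M)"
  shows "emeasure (swap_measure N) A = emeasure N ((\<lambda>(u, v). (v, u)) -` A \<inter> space (M \<Otimes>\<^sub>M M))"
proof -
  have "(\<lambda>(u, v). (v, u)) \<in> N \<rightarrow>\<^sub>M N"
    unfolding measurable_cong_sets[OF assms(1) assms(1)] by (rule measurable_pair_swap')
  then show ?thesis
    using assms by (simp add: swap_measure_def emeasure_distr sets_eq_imp_space_eq[OF assms(1)])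
qed

text \<open>The swap is its own inverse: if \<open>A\<close> is null for the swapped measure, its
  reflection is null for \<open>N\<close>, hence by \<open>ac\<close> null for the swapped measure,
  and reflecting back makes \<open>A\<close> null for \<open>N\<close>.\<close>

lemma absolutely_continuous_swap:
  assumes sets: "sets N = sets (M \<Otimes>\<^sub>M M)"
    and ac: "absolutely_continuous N (swap_measure N)"
  shows "absolutely_continuous (swap_measure N) N"
  unfolding absolutely_continuous_def
proof
  let ?swap = "\<lambda>(u, v). (v, u)"
  fix A assume A: "A \<in> null_sets (swap_measure N)"
  then have A': "A \<in> sets (M \<Otimes>\<^sub>M M)"
    using sets by (simp add: null_sets_def swap_measure_def)
  define B where "B = ?swap -` A \<inter> space (M \<Otimes>\<^sub>M M)"
  have B: "B \<in> sets (M \<Otimes>\<^sub>M M)"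
    unfolding B_def by (rule measurable_sets[OF measurable_pair_swap' A'])
  have AB: "?swap -` B \<inter> space (M \<Otimes>\<^sub>M M) = A"
    using sets.sets_into_space[OF A'] by (auto simp: B_def space_pair_measure)
  have "B \<in> null_sets N"
    using A B emeasure_swap_measure[OF sets A'] sets by (simp add: null_sets_def B_def)
  then have "B \<in> null_sets (swap_measure N)"
    using ac by (auto simp: absolutely_continuous_def)
  then show "A \<in> null_sets N"
    using A' emeasure_swap_measure[OF sets B] sets by (simp add: null_sets_def AB)
qed

section \<open>The Metropolis-Hastings kernel for a general acceptance function\<close>

lemma sets_mh_kernel [simp]: "sets (mh_kernel M S \<alpha> u) = sets M"
  by (simp add: mh_kernel_def)

lemma emeasure_mh_kernel:
  assumes S: "S \<in> M \<rightarrow>\<^sub>M M" and \<alpha>: "\<alpha> \<in> borel_measurable (M \<Otimes>\<^sub>M M)"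
    and u: "u \<in> space M" and A: "A \<in> sets M"
  shows "emeasure (mh_kernel M S \<alpha> u) A =
    \<alpha> (u, S u) * indicator A (S u) + (1 - \<alpha> (u, S u)) * indicator A u"
proof -
  have [measurable]: "(\<lambda>v. \<alpha> (u, v)) \<in> borel_measurable M"
    by (rule measurable_compose[OF measurable_Pair1'[OF u] \<alpha>])
  have Su: "S u \<in> space M"
    using S u by (rule measurable_space)
  have "emeasure (density (return M (S u)) (\<lambda>v. \<alpha> (u, v))) A = \<alpha> (u, S u) * indicator A (S u)"
    using A Su by (simp add: emeasure_density nn_integral_return)
  then show ?thesis
    using A u by (simp add: mh_kernel_def emeasure_sum_measure)
qed

text \<open>Under \<open>le\<close> the truncated difference is a genuine one, so the accepted and
  rejected masses add up to 1. The bound is pointwise because every slice has to be a probability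
  measure.\<close>

lemma measurable_mh_kernel:
  assumes S: "S \<in> M \<rightarrow>\<^sub>M M" and \<alpha>: "\<alpha> \<in> borel_measurable (M \<Otimes>\<^sub>M M)"
    and le: "\<And>p. \<alpha> p \<le> 1"
  shows "mh_kernel M S \<alpha> \<in> M \<rightarrow>\<^sub>M prob_algebra M"
proof -
  note S[measurable] \<alpha>[measurable]
  have prob: "prob_space (mh_kernel M S \<alpha> u)" if u: "u \<in> space M" for u
  proof (rule prob_spaceI)
    have "S u \<in> space M"
      using S u by (rule measurable_space)
    then show "emeasure (mh_kernel M S \<alpha> u) (space (mh_kernel M S \<alpha> u)) = 1"
      using u le by (simp add: sets_eq_imp_space_eq[OF sets_mh_kernel]
          emeasure_mh_kernel[OF S \<alpha> u] add_diff_inverse_ennreal)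
  qed
  show ?thesis
  proof (rule measurable_prob_algebraI[OF prob])
    show "mh_kernel M S \<alpha> \<in> M \<rightarrow>\<^sub>M subprob_algebra M"
    proof (rule measurable_subprob_algebra)
      fix A assume [measurable]: "A \<in> sets M"
      show "(\<lambda>u. emeasure (mh_kernel M S \<alpha> u) A) \<in> borel_measurable M"
        by (subst measurable_cong[OF emeasure_mh_kernel[OF S \<alpha>]]) measurable
    qed (use prob in \<open>auto intro: prob_space_imp_subprob_space\<close>)
  qed
qed

text \<open>The rejected mass sits at points \<open>(u, u)\<close>, which the swap fixes, so
  reversibility reduces to \<open>sym\<close>, the invariance of the accepted mass on the graph of
  \<open>S\<close>.\<close>

lemma detailed_balance_mh_kernel:
  assumes M: "prob_space M" and S [measurable]: "S \<in> M \<rightarrow>\<^sub>M M"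
    and \<alpha> [measurable]: "\<alpha> \<in> borel_measurable (M \<Otimes>\<^sub>M M)" and le: "\<And>p. \<alpha> p \<le> 1"
    and sym: "\<And>A. A \<in> sets (M \<Otimes>\<^sub>M M) \<Longrightarrow>
      (\<integral>\<^sup>+u. \<alpha> (u, S u) * indicator A (u, S u) \<partial>M) = (\<integral>\<^sup>+u. \<alpha> (u, S u) * indicator A (S u, u) \<partial>M)"
  shows "detailed_balance M (mh_kernel M S \<alpha>)"
  unfolding detailed_balance_def
proof (rule measure_eqI)
  let ?K = "mh_kernel M S \<alpha>"
  have K: "?K \<in> M \<rightarrow>\<^sub>M prob_algebra M"
    by (rule measurable_mh_kernel[OF S \<alpha> le])
  note sets = sets_kernel_joint[OF M K]
  have joint: "emeasure (kernel_joint M ?K) A =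
      (\<integral>\<^sup>+u. \<alpha> (u, S u) * indicator A (u, S u) \<partial>M) + (\<integral>\<^sup>+u. (1 - \<alpha> (u, S u)) * indicator A (u, u) \<partial>M)"
    if A [measurable]: "A \<in> sets (M \<Otimes>\<^sub>M M)" for A
  proof -
    have "emeasure (kernel_joint M ?K) A =
        (\<integral>\<^sup>+u. \<alpha> (u, S u) * indicator A (u, S u) + (1 - \<alpha> (u, S u)) * indicator A (u, u) \<partial>M)"
      unfolding emeasure_kernel_joint_section[OF M K A]
      by (rule nn_integral_cong)
        (simp add: emeasure_mh_kernel[OF S \<alpha>] sets_Pair1[OF A] indicator_def)
    then show ?thesis
      by (simp add: nn_integral_add)
  qed
  show "sets (kernel_joint M ?K) = sets (swap_measure (kernel_joint M ?K))"
    by (simp add: swap_measure_def)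
  fix A assume "A \<in> sets (kernel_joint M ?K)"
  then have A: "A \<in> sets (M \<Otimes>\<^sub>M M)"
    by (simp add: sets)
  \<comment> \<open>Testing the swapped measure on \<open>A\<close> is testing the original one on
    the reflected set \<open>B\<close>, so \<open>joint\<close> serves both sides.\<close>
  define B where "B = (\<lambda>(u, v). (v, u)) -` A \<inter> space (M \<Otimes>\<^sub>M M)"
  have B: "B \<in> sets (M \<Otimes>\<^sub>M M)"
    unfolding B_def by (rule measurable_sets[OF measurable_pair_swap' A])
  have ind: "indicator B (u, v) = (indicator A (v, u) :: ennreal)"
    if "u \<in> space M" "v \<in> space M" for u v
    using that by (simp add: B_def indicator_def space_pair_measure)
  have "emeasure (swap_measure (kernel_joint M ?K)) A = emeasure (kernel_joint M ?K) B"
    unfolding emeasure_swap_measure[OF sets A] B_def ..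
  also have "\<dots> =
      (\<integral>\<^sup>+u. \<alpha> (u, S u) * indicator A (S u, u) \<partial>M) + (\<integral>\<^sup>+u. (1 - \<alpha> (u, S u)) * indicator A (u, u) \<partial>M)"
    unfolding joint[OF B]
    by (intro arg_cong2[where f = "(+)"] nn_integral_cong)
      (simp_all add: ind measurable_space[OF S])
  finally show "emeasure (kernel_joint M ?K) A = emeasure (swap_measure (kernel_joint M ?K)) A"
    by (simp add: joint[OF A] sym[OF A])
qed

section \<open>Change of variables and the reciprocal relation for an involution\<close>

lemma min_one_mult_eq:
  fixes a b :: ennreal
  assumes "a * b = 1"
  shows "min 1 a * b = min 1 b"
proof (cases "a \<le> 1")
  case True
  \<comment> \<open>As the product is 1, the factors lie on opposite sides of 1, so each case
    decides both minima.\<close>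
  then have "1 \<le> b"
    using assms mult_right_mono[of a 1 b] by simp
  with True assms show ?thesis
    by (simp add: min_def)
next
  case False
  then have "b \<le> 1"
    using assms mult_right_mono[of 1 a b] by simp
  with False show ?thesis
    by (simp add: min_def not_le less_imp_le)
qed

text \<open>Since \<open>h u = h (S (S u))\<close>, the left side integrates \<open>h (S u)\<close>
  against the pushforward of \<open>M\<close>, whose density is \<open>r\<close>.\<close>

lemma nn_integral_involution_density:
  assumes S: "S \<in> M \<rightarrow>\<^sub>M M" and inv: "\<And>u. u \<in> space M \<Longrightarrow> S (S u) = u"
    and r: "r \<in> borel_measurable M" and dens: "distr M M S = density M r"
    and h: "h \<in> borel_measurable M"
  shows "(\<integral>\<^sup>+u. h u \<partial>M) = (\<integral>\<^sup>+u. r u * h (S u) \<partial>M)"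
proof -
  note [measurable] = S h r
  have "(\<integral>\<^sup>+u. h u \<partial>M) = (\<integral>\<^sup>+u. h (S (S u)) \<partial>M)"
    by (rule nn_integral_cong) (simp add: inv)
  also have "\<dots> = (\<integral>\<^sup>+u. h (S u) \<partial>distr M M S)"
    by (simp add: nn_integral_distr)
  also have "\<dots> = (\<integral>\<^sup>+u. r u * h (S u) \<partial>M)"
    unfolding dens by (simp add: nn_integral_density)
  finally show ?thesis .
qed

text \<open>Two changes of variables carry the integral of \<open>r (S u) * r u\<close> over any
  \<open>A\<close> to the measure of \<open>A\<close>. The product and the constant 1 are then
  densities of the same measure, and sigma-finiteness makes them agree almost everywhere.\<close>

lemma AE_involution_density_reciprocal:
  assumes "sigma_finite_measure M"
    and S: "S \<in> M \<rightarrow>\<^sub>M M" and inv: "\<And>u. u \<in> space M \<Longrightarrow> S (S u) = u"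
    and r: "r \<in> borel_measurable M" and dens: "distr M M S = density M r"
  shows "AE u in M. r (S u) * r u = 1"
proof -
  interpret sigma_finite_measure M by fact
  note [measurable] = S r
  note change = nn_integral_involution_density[OF S inv r dens]
  have "density M (\<lambda>u. r (S u) * r u) = density M (\<lambda>_. 1)"
  proof (rule measure_eqI)
    fix A assume "A \<in> sets (density M (\<lambda>u. r (S u) * r u))"
    then have A [measurable]: "A \<in> sets M" by simp
    have "emeasure (density M (\<lambda>u. r (S u) * r u)) A = (\<integral>\<^sup>+u. r u * (r (S u) * indicator A u) \<partial>M)"
      by (simp add: emeasure_density mult_ac)
    \<comment> \<open>This exposes the form \<open>r u * h (S u)\<close> with
      \<open>h v = r v * indicator A (S v)\<close>.\<close>
    also have "\<dots> = (\<integral>\<^sup>+u. r u * (r (S u) * indicator A (S (S u))) \<partial>M)"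
      by (rule nn_integral_cong) (simp add: inv)
    also have "\<dots> = (\<integral>\<^sup>+u. r u * indicator A (S u) \<partial>M)"
      by (rule change[symmetric]) measurable
    also have "\<dots> = (\<integral>\<^sup>+u. indicator A u \<partial>M)"
      by (rule change[symmetric]) measurable
    finally show "emeasure (density M (\<lambda>u. r (S u) * r u)) A = emeasure (density M (\<lambda>_. 1)) A"
      by (simp add: emeasure_density)
  qed simp
  then show ?thesis
    by (subst (asm) density_unique_iff) auto
qed

text \<open>This supplies \<open>sym\<close> for the acceptance function
  \<open>min 1 (r (fst p))\<close>. Changing variables restores the order \<open>(u, S u)\<close> at
  the cost of the weight \<open>min 1 (r (S u)) * r u\<close>, which the reciprocal relation
  collapses to \<open>min 1 (r u)\<close>.\<close>

lemma nn_integral_acceptance_sym: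
  assumes "sigma_finite_measure M"
    and S: "S \<in> M \<rightarrow>\<^sub>M M" and inv: "\<And>u. u \<in> space M \<Longrightarrow> S (S u) = u"
    and r: "r \<in> borel_measurable M" and dens: "distr M M S = density M r"
    and A: "A \<in> sets (M \<Otimes>\<^sub>M M)"
  shows "(\<integral>\<^sup>+u. min 1 (r u) * indicator A (u, S u) \<partial>M) = (\<integral>\<^sup>+u. min 1 (r u) * indicator A (S u, u) \<partial>M)"
proof -
  note [measurable] = S r A
  have reciprocal: "AE u in M. r (S u) * r u = 1"
    using assms(1-5) by (rule AE_involution_density_reciprocal)
  have "(\<integral>\<^sup>+u. min 1 (r u) * indicator A (S u, u) \<partial>M)
      = (\<integral>\<^sup>+u. r u * (min 1 (r (S u)) * indicator A (S (S u), S u)) \<partial>M)"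
    by (rule nn_integral_involution_density[OF S inv r dens]) measurable
  also have "\<dots> = (\<integral>\<^sup>+u. min 1 (r u) * indicator A (u, S u) \<partial>M)"
  proof (rule nn_integral_cong_AE)
    show "AE u in M. r u * (min 1 (r (S u)) * indicator A (S (S u), S u)) =
        min 1 (r u) * indicator A (u, S u)"
      using AE_space reciprocal
    proof eventually_elim
      case (elim u)
      from min_one_mult_eq[OF elim(2)] show ?case
        by (simp add: inv[OF elim(1)] mult.assoc[symmetric] mult.commute[of "r u"])
    qed
  qed
  finally show ?thesis ..
qed

section \<open>The measures \<open>eta\<close> and \<open>eta_perp\<close> on the graph of
  \<open>S\<close>\<close>

lemma measurable_det_kernel:
  assumes "S \<in> M \<rightarrow>\<^sub>M M"
  shows "det_kernel M S \<in> M \<rightarrow>\<^sub>M prob_algebra M"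
  unfolding det_kernel_def
  by (rule measurable_compose[OF assms measurable_return_prob_space])

lemma eta_eq_distr:
  assumes M: "prob_space M" and S [measurable]: "S \<in> M \<rightarrow>\<^sub>M M"
  shows "eta M S = distr M (M \<Otimes>\<^sub>M M) (\<lambda>u. (u, S u))"
proof (rule measure_eqI)
  note K = measurable_det_kernel[OF S]
  show sets: "sets (eta M S) = sets (distr M (M \<Otimes>\<^sub>M M) (\<lambda>u. (u, S u)))"
    by (simp add: eta_def sets_kernel_joint[OF M K])
  fix A assume "A \<in> sets (eta M S)"
  then have A [measurable]: "A \<in> sets (M \<Otimes>\<^sub>M M)"
    by (simp add: sets)
  have "emeasure (eta M S) A = (\<integral>\<^sup>+u. indicator A (u, S u) \<partial>M)"
    unfolding eta_def emeasure_kernel_joint_section[OF M K A]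
    by (rule nn_integral_cong) (simp add: det_kernel_def sets_Pair1[OF A] indicator_def)
  also have "\<dots> = (\<integral>\<^sup>+p. indicator A p \<partial>distr M (M \<Otimes>\<^sub>M M) (\<lambda>u. (u, S u)))"
    by (rule nn_integral_distr[symmetric]) measurable
  finally show "emeasure (eta M S) A = emeasure (distr M (M \<Otimes>\<^sub>M M) (\<lambda>u. (u, S u))) A"
    by simp
qed

lemma eta_perp_eq_density:
  assumes M: "prob_space M" and S: "S \<in> M \<rightarrow>\<^sub>M M"
    and inv: "\<And>u. u \<in> space M \<Longrightarrow> S (S u) = u"
    and r: "r \<in> borel_measurable M" and dens: "distr M M S = density M r"
  shows "eta_perp M S = density (eta M S) (\<lambda>p. r (fst p))"
proof -
  note [measurable] = S r
  let ?G = "\<lambda>u. (u, S u)"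
  note eta = eta_eq_distr[OF M S]
  have "eta_perp M S = distr M (M \<Otimes>\<^sub>M M) (\<lambda>u. (S u, u))"
    unfolding eta_perp_def swap_measure_def
    by (simp add: eta distr_distr comp_def cong: distr_cong)
  \<comment> \<open>By the involution, \<open>(S u, u)\<close> is the graph map evaluated at
    \<open>S u\<close>.\<close>
  also have "\<dots> = distr M (M \<Otimes>\<^sub>M M) (?G \<circ> S)"
    by (rule distr_cong) (simp_all add: inv)
  also have "\<dots> = distr (density M r) (M \<Otimes>\<^sub>M M) ?G"
    unfolding dens[symmetric] by (rule distr_distr[symmetric]) measurable
  \<comment> \<open>The density passes through the graph map because
    \<open>fst (u, S u) = u\<close>.\<close>
  also have "\<dots> = density (eta M S) (\<lambda>p. r (fst p))"
    unfolding eta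
    by (subst density_distr) simp_all
  finally show ?thesis .
qed

theorem theorem3p6:
  fixes M :: "'a measure" and S :: "'a \<Rightarrow> 'a"
  assumes prob: "prob_space M"
    and meas: "S \<in> M \<rightarrow>\<^sub>M M"
    and P1: "\<forall>u\<in>space M. S (S u) = u"
    and P2: "absolutely_continuous M (distr M M S)"
  shows
    "det_kernel M S \<in> M \<rightarrow>\<^sub>M prob_algebra M
     \<and> absolutely_continuous (eta M S) (eta_perp M S)
     \<and> absolutely_continuous (eta_perp M S) (eta M S)
     \<and> (AE (u, v) in eta M S.
          RN_deriv (eta M S) (eta_perp M S) (u, v) = RN_deriv M (distr M M S) u)
     \<and> (\<forall>f \<in> borel_measurable (M \<Otimes>\<^sub>M M).
          (AE p in eta M S. f p = RN_deriv (eta M S) (eta_perp M S) p) \<longrightarrow>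
          mh_kernel M S (\<lambda>p. min 1 (f p)) \<in> M \<rightarrow>\<^sub>M prob_algebra M
          \<and> detailed_balance M (mh_kernel M S (\<lambda>p. min 1 (f p))))"
proof -
  interpret prob_space M by (rule prob)
  note [measurable] = meas
  have inv: "S (S u) = u" if "u \<in> space M" for u
    using P1 that by simp
  define r where "r = RN_deriv M (distr M M S)"
  have r [measurable]: "r \<in> borel_measurable M"
    by (simp add: r_def)
  have dens: "distr M M S = density M r"
    unfolding r_def using P2 by (simp add: density_RN_deriv)
  note eta = eta_eq_distr[OF prob meas]
  have perp: "eta_perp M S = density (eta M S) (\<lambda>p. r (fst p))"
    using prob meas inv r dens by (rule eta_perp_eq_density)
  have sets_eta: "sets (eta M S) = sets (M \<Otimes>\<^sub>M M)"
    by (simp add: eta)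
  have r_fst: "(\<lambda>p. r (fst p)) \<in> borel_measurable (eta M S)"
    unfolding eta by simp
  have "prob_space (eta M S)"
    unfolding eta by (rule prob_space_distr) measurable
  then interpret eta: prob_space "eta M S" .
  have ac: "absolutely_continuous (eta M S) (eta_perp M S)"
    unfolding perp by (rule absolutely_continuousI_density[OF r_fst])
  have ac': "absolutely_continuous (eta_perp M S) (eta M S)"
    using absolutely_continuous_swap[OF sets_eta] ac unfolding eta_perp_def by simp
  have RN: "AE p in eta M S. r (fst p) = RN_deriv (eta M S) (eta_perp M S) p"
    using r_fst perp[symmetric] by (rule eta.RN_deriv_unique)
  \<comment> \<open>The derivative is determined only up to \<open>eta\<close>-null sets, so the
    claim is made for every measurable version \<open>f\<close>.\<close>
  have mh: "mh_kernel M S (\<lambda>p. min 1 (f p)) \<in> M \<rightarrow>\<^sub>M prob_algebra M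
      \<and> detailed_balance M (mh_kernel M S (\<lambda>p. min 1 (f p)))"
    if f [measurable]: "f \<in> borel_measurable (M \<Otimes>\<^sub>M M)"
      and f_eq: "AE p in eta M S. f p = RN_deriv (eta M S) (eta_perp M S) p" for f
  proof
    have \<alpha>: "(\<lambda>p. min 1 (f p)) \<in> borel_measurable (M \<Otimes>\<^sub>M M)"
      by measurable
    have "AE p in eta M S. f p = r (fst p)"
      using f_eq RN by eventually_elim simp
    \<comment> \<open>\<open>eta\<close> is the image of \<open>M\<close> under the graph map, so
      agreement \<open>eta\<close>-a.e. becomes agreement \<open>M\<close>-a.e. along the graph, the
      only place where the values of \<open>f\<close> matter for the kernel.\<close>
    then have f_r: "AE u in M. f (u, S u) = r u"
      unfolding eta by (subst (asm) AE_distr_iff) auto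
    \<comment> \<open>The cap at 1 acts at every point, even where \<open>f\<close> differs from the
      derivative, so no exceptional set arises here.\<close>
    show "mh_kernel M S (\<lambda>p. min 1 (f p)) \<in> M \<rightarrow>\<^sub>M prob_algebra M"
      by (rule measurable_mh_kernel[OF meas \<alpha>]) simp
    show "detailed_balance M (mh_kernel M S (\<lambda>p. min 1 (f p)))"
    proof (rule detailed_balance_mh_kernel[OF prob meas \<alpha>])
      fix A assume A: "A \<in> sets (M \<Otimes>\<^sub>M M)"
      have "(\<integral>\<^sup>+u. min 1 (f (u, S u)) * indicator A (u, S u) \<partial>M)
          = (\<integral>\<^sup>+u. min 1 (r u) * indicator A (u, S u) \<partial>M)"
        by (rule nn_integral_cong_AE) (use f_r in eventually_elim, simp)
      also have "\<dots> = (\<integral>\<^sup>+u. min 1 (r u) * indicator A (S u, u) \<partial>M)"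
        using sigma_finite_measure_axioms meas inv r dens A by (rule nn_integral_acceptance_sym)
      also have "\<dots> = (\<integral>\<^sup>+u. min 1 (f (u, S u)) * indicator A (S u, u) \<partial>M)"
        by (rule nn_integral_cong_AE) (use f_r in eventually_elim, simp)
      finally show "(\<integral>\<^sup>+u. min 1 (f (u, S u)) * indicator A (u, S u) \<partial>M)
          = (\<integral>\<^sup>+u. min 1 (f (u, S u)) * indicator A (S u, u) \<partial>M)" .
    qed simp
  qed
  show ?thesis
  proof (intro conjI ballI impI)
    show "AE (u, v) in eta M S.
        RN_deriv (eta M S) (eta_perp M S) (u, v) = RN_deriv M (distr M M S) u"
      using RN by eventually_elim (simp add: r_def split_beta)
  qed (use measurable_det_kernel[OF meas] ac ac' mh in auto)
qed

end
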